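(* For all positive integers $n$ and $s$ and every odd positive integer $m=2k+1$, $$N(SO(2n+1),m,s)=N(O(2n+1),m,s)=N(O(2n),m,s)=\frac{s}{n}\binom{n}{s}\binom{[m/2]+1}{s}.$$
   Context: $O(N)$ is the group of real $N\times N$ orthogonal matrices and $SO(N)$ its subgroup of determinant-$1$ matrices. For real $\theta$ let $A(\theta)=\begin{pmatrix}\cos 2\pi\theta & \sin 2\pi\theta\\ -\sin 2\pi\theta & \cos2\pi\theta\end{pmatrix}$ and $B=\mathrm{diag}(1,-1)$. Every element of $SO(2n+1)$ is conjugate in the group to $\mathrm{diag}(A(\theta_1),\dots,A(\theta_n),1)$; every element of $O(2n+1)$ to $\mathrm{diag}(A(\theta_1),\dots,A(\theta_n),\pm1)$; every element of $O(2n)$ of determinant $1$ to $\mathrm{diag}(A(\theta_1),\dots,A(\theta_n))$ and of determinant $-1$ to $\mathrm{diag}(A(\theta_1),\dots,A(\theta_{n-1}),B)$. Replacing each $\theta_l$ by the unique number in $[0,1/2]$ congruent to $\pm\theta_l$ modulo $1$, the number of distinct conjugate pairs of eigenvalues of the element is the number of distinct values among the $\theta_l$ in such a form. $N(G,m,s)$ denotes the number of conjugacy classes of $G$ (under conjugation by elements of $G$) consisting of elements $x$ with $x^m=1$ having exactly $s$ distinct conjugate pairs of eigenvalues. $[\cdot]$ denotes the integer part (floor). *)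

theory Defs
  imports "HOL-Algebra.Group_Action" "Jordan_Normal_Form.Determinant" Complex_Main
begin

definition orthogonal_group :: "nat \<Rightarrow> real mat monoid" where
  "orthogonal_group N =
    \<lparr>carrier = {x \<in> carrier_mat N N. transpose_mat x * x = 1\<^sub>m N},
     monoid.mult = (*), one = 1\<^sub>m N\<rparr>"

definition special_orthogonal_group :: "nat \<Rightarrow> real mat monoid" where
  "special_orthogonal_group N =
    \<lparr>carrier = {x \<in> carrier (orthogonal_group N). det x = 1},
     monoid.mult = (*), one = 1\<^sub>m N\<rparr>"

lemma orthogonal_transpose:
  assumes "x \<in> carrier (orthogonal_group N)"
  shows "transpose_mat x \<in> carrier (orthogonal_group N)" "x * transpose_mat x = 1\<^sub>m N"
proof -
  have x: "x \<in> carrier_mat N N" "transpose_mat x * x = 1\<^sub>m N"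
    using assms by (auto simp: orthogonal_group_def)
  then show *: "x * transpose_mat x = 1\<^sub>m N"
    using mat_mult_left_right_inverse[of "transpose_mat x" N x] by simp
  then show "transpose_mat x \<in> carrier (orthogonal_group N)"
    using x by (simp add: orthogonal_group_def)
qed

lemma group_orthogonal_group: "group (orthogonal_group N)"
proof (rule groupI)
  fix x y assume xy: "x \<in> carrier (orthogonal_group N)" "y \<in> carrier (orthogonal_group N)"
  then have c: "x \<in> carrier_mat N N" "y \<in> carrier_mat N N"
    "transpose_mat x * x = 1\<^sub>m N" "transpose_mat y * y = 1\<^sub>m N"
    by (auto simp: orthogonal_group_def)
  have "transpose_mat (x * y) * (x * y) = (transpose_mat y * transpose_mat x) * (x * y)"
    using c by (simp add: transpose_mult)
  also have "\<dots> = transpose_mat y * (transpose_mat x * (x * y))"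
    using c by (intro assoc_mult_mat[of _ N N _ N _ N]) auto
  also have "transpose_mat x * (x * y) = (transpose_mat x * x) * y"
    using c by (intro assoc_mult_mat[of _ N N _ N _ N, symmetric]) auto
  finally have "transpose_mat (x * y) * (x * y) = 1\<^sub>m N"
    using c by simp
  then show "x \<otimes>\<^bsub>orthogonal_group N\<^esub> y \<in> carrier (orthogonal_group N)"
    using c by (simp add: orthogonal_group_def)
next
  fix x assume x: "x \<in> carrier (orthogonal_group N)"
  show "\<exists>y\<in>carrier (orthogonal_group N). y \<otimes>\<^bsub>orthogonal_group N\<^esub> x = \<one>\<^bsub>orthogonal_group N\<^esub>"
    using x orthogonal_transpose(1)[OF x]
    by (intro bexI[of _ "transpose_mat x"]) (auto simp: orthogonal_group_def)
qed (auto simp: orthogonal_group_def intro: assoc_mult_mat)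

lemma subgroup_special_orthogonal:
  "subgroup (carrier (special_orthogonal_group N)) (orthogonal_group N)"
proof -
  interpret group "orthogonal_group N" by (rule group_orthogonal_group)
  have inv_eq: "inv\<^bsub>orthogonal_group N\<^esub> x = transpose_mat x"
    if "x \<in> carrier (orthogonal_group N)" for x
    using that orthogonal_transpose[OF that]
    by (intro inv_equality) (auto simp: orthogonal_group_def)
  have sub: "carrier (special_orthogonal_group N) \<subseteq> carrier (orthogonal_group N)"
    by (auto simp: special_orthogonal_group_def)
  show ?thesis
  proof (rule subgroupI[OF sub])
    have "\<one>\<^bsub>orthogonal_group N\<^esub> \<in> carrier (special_orthogonal_group N)"
      by (simp add: special_orthogonal_group_def orthogonal_group_def)
    then show "carrier (special_orthogonal_group N) \<noteq> {}" by blast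
  next
    fix a assume a: "a \<in> carrier (special_orthogonal_group N)"
    then have "a \<in> carrier (orthogonal_group N)" using sub by blast
    moreover have "a \<in> carrier_mat N N"
      using calculation by (simp add: orthogonal_group_def)
    ultimately show "inv\<^bsub>orthogonal_group N\<^esub> a \<in> carrier (special_orthogonal_group N)"
      using a orthogonal_transpose(1)[of a N]
      by (simp add: inv_eq special_orthogonal_group_def det_transpose)
  next
    fix a b assume ab: "a \<in> carrier (special_orthogonal_group N)"
      "b \<in> carrier (special_orthogonal_group N)"
    then have *: "a \<in> carrier (orthogonal_group N)" "b \<in> carrier (orthogonal_group N)"
      using sub by auto
    have "det (a * b) = 1"
      using ab * det_mult[of a N b]
      by (simp add: special_orthogonal_group_def orthogonal_group_def)
    then show "a \<otimes>\<^bsub>orthogonal_group N\<^esub> b \<in> carrier (special_orthogonal_group N)"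
      using m_closed[OF *] by (simp add: special_orthogonal_group_def orthogonal_group_def)
  qed
qed

lemma group_special_orthogonal_group: "group (special_orthogonal_group N)"
  using group.subgroup_imp_group[OF group_orthogonal_group subgroup_special_orthogonal]
  by (simp add: special_orthogonal_group_def orthogonal_group_def)

definition rot :: "real \<Rightarrow> real mat" where
  "rot \<theta> = mat_of_rows_list 2
    [[cos (2 * pi * \<theta>), sin (2 * pi * \<theta>)],
     [- sin (2 * pi * \<theta>), cos (2 * pi * \<theta>)]]"

definition refl_block :: "real mat" where
  "refl_block = mat_of_rows_list 2 [[1, 0], [0, -1]]"

definition fold_angle :: "real \<Rightarrow> real" where
  "fold_angle \<theta> = (THE t. 0 \<le> t \<and> t \<le> 1 / 2 \<and>
     (\<exists>j::int. t = \<theta> + of_int j \<or> t = - \<theta> + of_int j))"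

lemma fold_angle_ex1:
  "\<exists>!t. 0 \<le> t \<and> t \<le> 1 / 2 \<and> (\<exists>j::int. t = \<theta> + of_int j \<or> t = - \<theta> + of_int j)"
  for \<theta> :: real
proof (rule ex_ex1I)
  show "\<exists>t. 0 \<le> t \<and> t \<le> 1 / 2 \<and> (\<exists>j::int. t = \<theta> + of_int j \<or> t = - \<theta> + of_int j)"
  proof (cases "frac \<theta> \<le> 1 / 2")
    case True
    then show ?thesis
      by (intro exI[of _ "frac \<theta>"] conjI exI[of _ "- \<lfloor>\<theta>\<rfloor>"]) (auto simp: frac_def)
  next
    case False
    then show ?thesis
      using frac_lt_1[of \<theta>]
      by (intro exI[of _ "1 - frac \<theta>"] conjI exI[of _ "\<lfloor>\<theta>\<rfloor> + 1"]) (auto simp: frac_def)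
  qed
next
  fix t u :: real
  assume t: "0 \<le> t \<and> t \<le> 1 / 2 \<and> (\<exists>j::int. t = \<theta> + of_int j \<or> t = - \<theta> + of_int j)"
    and u: "0 \<le> u \<and> u \<le> 1 / 2 \<and> (\<exists>j::int. u = \<theta> + of_int j \<or> u = - \<theta> + of_int j)"
  then obtain j where j: "t - u = of_int j \<or> t + u = of_int j"
  proof -
    obtain a where a: "t = \<theta> + of_int a \<or> t = - \<theta> + of_int a" using t by blast
    obtain b where b: "u = \<theta> + of_int b \<or> u = - \<theta> + of_int b" using u by blast
    have "t - u = of_int (a - b) \<or> t + u = of_int (a + b)" using a b by auto
    then show ?thesis using that by blast
  qed
  from j show "t = u"
  proof
    assume e: "t - u = of_int j"
    then have "\<bar>of_int j :: real\<bar> < 1" using t u by linarith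
    then have "j = 0" by linarith
    then show ?thesis using e by simp
  next
    assume e: "t + u = of_int j"
    then have "0 \<le> (of_int j :: real)" "(of_int j :: real) \<le> 1" using t u by linarith+
    then have "j = 0 \<or> j = 1" by linarith
    then show ?thesis
    proof
      assume "j = 0"
      then show ?thesis using e t u by simp
    next
      assume "j = 1"
      then show ?thesis using e t u by simp
    qed
  qed
qed

(* The groups below are matrix groups. The last block of a standard form is determined by the
   parity of the size and the determinant: absent (even size, determinant 1), refl_block
   (even size, determinant -1), or the 1 x 1 block 1 or -1 (odd size). The number of rotation
   blocks is then forced by the size of the matrix, because a conjugate of x has the size of x. *)
definition standard_form :: "real list \<Rightarrow> real mat \<Rightarrow> bool" where
  "standard_form \<theta>s y \<longleftrightarrow>
    (\<exists>tail \<in> {[], [refl_block], [1\<^sub>m 1], [- 1\<^sub>m 1]}. y = diag_block_mat (map rot \<theta>s @ tail))"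

(* The trailing block does not contribute to the count. The standard form of x is unique up to
   the order of the angles and replacing angles by others with the same fold_angle, so s is
   determined by x. *)
definition has_conj_pairs :: "real mat monoid \<Rightarrow> real mat \<Rightarrow> nat \<Rightarrow> bool" where
  "has_conj_pairs G x s \<longleftrightarrow>
    (\<exists>g \<in> carrier G. \<exists>\<theta>s. standard_form \<theta>s (g \<otimes>\<^bsub>G\<^esub> x \<otimes>\<^bsub>G\<^esub> inv\<^bsub>G\<^esub> g) \<and>
       card (fold_angle ` set \<theta>s) = s)"

definition conjugacy_classes :: "('a, 'b) monoid_scheme \<Rightarrow> 'a set set" where
  "conjugacy_classes G = orbits G (carrier G) (\<lambda>g x. g \<otimes>\<^bsub>G\<^esub> x \<otimes>\<^bsub>G\<^esub> inv\<^bsub>G\<^esub> g)"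

definition num_classes :: "real mat monoid \<Rightarrow> nat \<Rightarrow> nat \<Rightarrow> nat" where
  "num_classes G m s =
    card {C \<in> conjugacy_classes G. \<forall>x\<in>C. x [^]\<^bsub>G\<^esub> m = \<one>\<^bsub>G\<^esub> \<and> has_conj_pairs G x s}"

end

theory Submission
  imports Defs "Jordan_Normal_Form.Char_Poly" "HOL-Library.Multiset"
begin

text \<open>An element of odd order has determinant 1 and no eigenvalue \<open>-1\<close> in its last block, so its
  standard form is a sum of \<open>N div 2\<close> rotations, followed by a block 1 if \<open>N\<close> is odd. Permuting and
  reflecting blocks are orthogonal conjugations, hence its class depends only on the multiset of folded
  angles; conversely the characteristic polynomial recovers the cosines of these angles. Folded
  angles of order dividing \<open>m = 2k + 1\<close> are the \<open>j/m\<close> with \<open>j \<le> k\<close>, so all three groups lead to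
  counting the multisets of size \<open>n\<close> in \<open>{0..k}\<close> with \<open>s\<close> distinct elements. Choosing the support
  and then the multiplicities gives \<open>(k + 1 choose s) * (n - 1 choose s - 1)\<close>.\<close>

section \<open>Block sums of matrices\<close>

text \<open>A binary counterpart of \<open>diag_block_mat\<close>, so that products, transposes,
  determinants and characteristic polynomials can be computed one block at a time along the
  list.\<close>

definition block_sum :: "'a::zero mat \<Rightarrow> 'a mat \<Rightarrow> 'a mat" where
  "block_sum A B = four_block_mat A (0\<^sub>m (dim_row A) (dim_col B)) (0\<^sub>m (dim_row B) (dim_col A)) B"

lemma block_sum_carrier [simp]:
  "A \<in> carrier_mat a c \<Longrightarrow> B \<in> carrier_mat b d \<Longrightarrow> block_sum A B \<in> carrier_mat (a + b) (c + d)"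
  by (simp add: block_sum_def)

lemma diag_block_mat_Cons: "diag_block_mat (A # As) = block_sum A (diag_block_mat As)"
  by (simp add: block_sum_def Let_def)

lemma diag_block_mat_append_block_sum:
  "diag_block_mat (As @ Bs) = block_sum (diag_block_mat As) (diag_block_mat Bs)"
  by (simp add: block_sum_def diag_block_mat_append Let_def)

lemma block_sum_mult:
  fixes A :: "'a::semiring_0 mat"
  assumes "A \<in> carrier_mat a a" "A' \<in> carrier_mat a a" "B \<in> carrier_mat b b" "B' \<in> carrier_mat b b"
  shows "block_sum A B * block_sum A' B' = block_sum (A * A') (B * B')"
  using assms
    mult_four_block_mat[of A a a "0\<^sub>m a b" b "0\<^sub>m b a" b B A' a "0\<^sub>m a b" b "0\<^sub>m b a" B']
  by (simp add: block_sum_def)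

lemma block_sum_transpose:
  assumes "A \<in> carrier_mat a c" "B \<in> carrier_mat b d"
  shows "transpose_mat (block_sum A B) = block_sum (transpose_mat A) (transpose_mat B)"
  using assms by (simp add: block_sum_def transpose_four_block_mat[of A a c _ d _ b])

lemma block_sum_one: "block_sum (1\<^sub>m a) (1\<^sub>m b) = 1\<^sub>m (a + b)"
  by (simp add: block_sum_def)

lemma block_sum_eq_one:
  fixes A :: "'a::zero_neq_one mat"
  assumes "A \<in> carrier_mat a a" "B \<in> carrier_mat b b" "block_sum A B = 1\<^sub>m (a + b)"
  shows "A = 1\<^sub>m a" "B = 1\<^sub>m b"
proof -
  have ent: "block_sum A B $$ (i, j) = (if i = j then 1 else 0)" if "i < a + b" "j < a + b" for i j
    using assms that by simp
  show "A = 1\<^sub>m a"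
  proof (rule eq_matI)
    fix i j assume "i < dim_row (1\<^sub>m a :: 'a mat)" "j < dim_col (1\<^sub>m a :: 'a mat)"
    then show "A $$ (i, j) = 1\<^sub>m a $$ (i, j)"
      using ent[of i j] assms(1,2) by (auto simp: block_sum_def)
  qed (use assms in auto)
  show "B = 1\<^sub>m b"
  proof (rule eq_matI)
    fix i j assume "i < dim_row (1\<^sub>m b :: 'a mat)" "j < dim_col (1\<^sub>m b :: 'a mat)"
    then show "B $$ (i, j) = 1\<^sub>m b $$ (i, j)"
      using ent[of "a + i" "a + j"] assms(1,2) by (auto simp: block_sum_def)
  qed (use assms in auto)
qed

text \<open>Peels off one block at a time by comparing entries. It allows an equation
  \<open>x ^ m = 1\<close> to be read off block by block.\<close>

lemma diag_block_mat_eq_one: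
  fixes As :: "'a::zero_neq_one mat list"
  assumes "\<And>A. A \<in> set As \<Longrightarrow> square_mat A" "diag_block_mat As = 1\<^sub>m N"
  shows "\<forall>A\<in>set As. A = 1\<^sub>m (dim_row A)"
  using assms
proof (induction As arbitrary: N)
  case (Cons A As)
  let ?D = "diag_block_mat As"
  have A: "A \<in> carrier_mat (dim_row A) (dim_row A)"
    using Cons.prems(1)[of A] by auto
  have D: "?D \<in> carrier_mat (dim_row ?D) (dim_row ?D)"
    using diag_block_mat_square[of As] Cons.prems(1) by auto
  have "N = dim_row A + dim_row ?D"
    using arg_cong[OF Cons.prems(2), of dim_row] by (simp add: Let_def)
  then have "block_sum A ?D = 1\<^sub>m (dim_row A + dim_row ?D)"
    using Cons.prems(2) by (simp only: diag_block_mat_Cons)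
  note eq = block_sum_eq_one[OF A D this]
  show ?case
    using eq(1) Cons.IH[OF _ eq(2)] Cons.prems(1) by simp
qed simp

lemma det_block_sum:
  fixes A :: "'a::idom mat"
  assumes "A \<in> carrier_mat a a" "B \<in> carrier_mat b b"
  shows "det (block_sum A B) = det A * det B"
  using assms by (simp add: block_sum_def det_four_block_mat_upper_right_zero[of A a _ b])

lemma char_poly_block_sum:
  fixes A :: "'a::idom mat"
  assumes "A \<in> carrier_mat a a" "B \<in> carrier_mat b b"
  shows "char_poly (block_sum A B) = char_poly A * char_poly B"
proof -
  have "char_poly_matrix (block_sum A B) = block_sum (char_poly_matrix A) (char_poly_matrix B)"
    by (rule eq_matI) (use assms in \<open>auto simp: char_poly_matrix_def block_sum_def\<close>)
  then show ?thesis
    using assms by (simp add: char_poly_def det_block_sum[of _ a _ b])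
qed

lemma det_2x2:
  fixes A :: "'a::idom mat"
  assumes "A \<in> carrier_mat 2 2"
  shows "det A = A $$ (0, 0) * A $$ (1, 1) - A $$ (0, 1) * A $$ (1, 0)"
proof -
  have d: "det M = M $$ (0, 0)" if "M \<in> carrier_mat (Suc 0) (Suc 0)" for M :: "'a mat"
    using that by (simp add: det_single)
  have "det A = (\<Sum>i<2. A $$ (i, 0) * cofactor A i 0)"
    using assms by (intro laplace_expansion_column) auto
  also have "\<dots> = A $$ (0, 0) * A $$ (1, 1) - A $$ (1, 0) * A $$ (0, 1)"
    using assms by (simp add: numeral_2_eq_2 cofactor_def d mat_delete_def)
  finally show ?thesis by (simp add: mult.commute)
qed

lemma det_pow_mat:
  assumes "A \<in> carrier_mat n n"
  shows "det (A ^\<^sub>m m) = (det A) ^ m"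
  using assms by (induction m) (auto simp: det_mult[of _ n] mult.commute)

section \<open>Orthogonal conjugacy\<close>

lemma orthogonal_group_simps [simp]:
  "x \<otimes>\<^bsub>orthogonal_group N\<^esub> y = x * y" "\<one>\<^bsub>orthogonal_group N\<^esub> = 1\<^sub>m N"
  by (simp_all add: orthogonal_group_def)

lemma orthogonal_group_iff:
  "x \<in> carrier (orthogonal_group N) \<longleftrightarrow> x \<in> carrier_mat N N \<and> transpose_mat x * x = 1\<^sub>m N"
  by (simp add: orthogonal_group_def)

lemma inv_orthogonal_group:
  assumes "x \<in> carrier (orthogonal_group N)"
  shows "inv\<^bsub>orthogonal_group N\<^esub> x = transpose_mat x"
  using assms orthogonal_transpose[OF assms]
  by (intro group.inv_equality[OF group_orthogonal_group]) (auto simp: orthogonal_group_iff)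

text \<open>The inverse is written as a transpose so that block sums of conjugating matrices can be
  computed directly. Requiring \<open>A\<close> to be orthogonal makes \<open>B\<close> orthogonal
  too, so this is an equivalence relation on \<open>O(N)\<close>.\<close>

definition orth_conj :: "nat \<Rightarrow> real mat \<Rightarrow> real mat \<Rightarrow> bool" where
  "orth_conj N A B \<longleftrightarrow> A \<in> carrier (orthogonal_group N) \<and>
     (\<exists>g\<in>carrier (orthogonal_group N). B = g * A * transpose_mat g)"

lemma orth_conj_group:
  "orth_conj N A B \<longleftrightarrow> A \<in> carrier (orthogonal_group N) \<and>
     (\<exists>g\<in>carrier (orthogonal_group N).
       B = g \<otimes>\<^bsub>orthogonal_group N\<^esub> A \<otimes>\<^bsub>orthogonal_group N\<^esub> inv\<^bsub>orthogonal_group N\<^esub> g)"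
  by (auto simp: orth_conj_def inv_orthogonal_group)

lemma (in group) conj_mult:
  assumes "g \<in> carrier G" "h \<in> carrier G" "x \<in> carrier G"
  shows "h \<otimes> (g \<otimes> x \<otimes> inv g) \<otimes> inv h = (h \<otimes> g) \<otimes> x \<otimes> inv (h \<otimes> g)"
  using assms by (simp add: m_assoc inv_mult_group)

lemma (in group) conj_inv:
  assumes "g \<in> carrier G" "x \<in> carrier G"
  shows "inv g \<otimes> (g \<otimes> x \<otimes> inv g) \<otimes> inv (inv g) = x"
  using assms conj_mult[of g "inv g" x] by simp

lemma orth_conj_refl: "A \<in> carrier (orthogonal_group N) \<Longrightarrow> orth_conj N A A"
  unfolding orth_conj_group
  using group.is_monoid[OF group_orthogonal_group[of N]]
  by (intro conjI bexI[of _ "\<one>\<^bsub>orthogonal_group N\<^esub>"])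
    (auto simp: monoid.inv_one monoid.r_one monoid.l_one simp del: orthogonal_group_simps)

lemma orth_conj_carrier:
  "orth_conj N A B \<Longrightarrow> A \<in> carrier (orthogonal_group N)"
  "orth_conj N A B \<Longrightarrow> B \<in> carrier (orthogonal_group N)"
proof -
  interpret group "orthogonal_group N" by (rule group_orthogonal_group)
  show "orth_conj N A B \<Longrightarrow> A \<in> carrier (orthogonal_group N)"
    "orth_conj N A B \<Longrightarrow> B \<in> carrier (orthogonal_group N)"
    unfolding orth_conj_group by (auto simp del: orthogonal_group_simps)
qed

lemma orth_conj_sym: "orth_conj N A B \<Longrightarrow> orth_conj N B A"
proof -
  interpret group "orthogonal_group N" by (rule group_orthogonal_group)
  assume AB: "orth_conj N A B"
  then obtain g where "g \<in> carrier (orthogonal_group N)" "A \<in> carrier (orthogonal_group N)"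
    "B = g \<otimes>\<^bsub>orthogonal_group N\<^esub> A \<otimes>\<^bsub>orthogonal_group N\<^esub> inv\<^bsub>orthogonal_group N\<^esub> g"
    unfolding orth_conj_group by blast
  then show ?thesis
    using conj_inv[of g A] orth_conj_carrier[OF AB] unfolding orth_conj_group by (metis inv_closed)
qed

lemma orth_conj_trans: "orth_conj N A B \<Longrightarrow> orth_conj N B C \<Longrightarrow> orth_conj N A C"
proof -
  interpret group "orthogonal_group N" by (rule group_orthogonal_group)
  show "orth_conj N A B \<Longrightarrow> orth_conj N B C \<Longrightarrow> orth_conj N A C"
    unfolding orth_conj_group by (metis conj_mult m_closed)
qed

lemma orthogonal_block_sum:
  assumes "A \<in> carrier (orthogonal_group a)" "B \<in> carrier (orthogonal_group b)"
  shows "block_sum A B \<in> carrier (orthogonal_group (a + b))"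
  using assms
  by (auto simp: orthogonal_group_iff block_sum_transpose[of _ a a _ b b]
      block_sum_mult[of _ a _ _ b] block_sum_one)

lemma orth_conj_block_sum:
  assumes "orth_conj a A A'" "orth_conj b B B'"
  shows "orth_conj (a + b) (block_sum A B) (block_sum A' B')"
proof -
  obtain g h where gh: "g \<in> carrier (orthogonal_group a)" "h \<in> carrier (orthogonal_group b)"
    "A' = g * A * transpose_mat g" "B' = h * B * transpose_mat h"
    using assms unfolding orth_conj_def by blast
  have AB: "A \<in> carrier (orthogonal_group a)" "B \<in> carrier (orthogonal_group b)"
    using assms by (auto simp: orth_conj_def)
  have "block_sum A' B' = block_sum g h * block_sum A B * transpose_mat (block_sum g h)"
    using gh AB by (simp add: orthogonal_group_iff block_sum_transpose[of _ a a _ b b]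
      block_sum_mult[of _ a _ _ b] mult_carrier_mat[of _ a a _ a] mult_carrier_mat[of _ b b _ b])
  then show ?thesis
    unfolding orth_conj_def using gh AB orthogonal_block_sum by blast
qed

text \<open>Exchanging two diagonal blocks is conjugation by the permutation matrix \<open>P\<close>
  that moves the last \<open>b\<close> coordinates in front of the first \<open>a\<close>.\<close>

lemma orth_conj_block_sum_swap:
  assumes A: "A \<in> carrier (orthogonal_group a)" and B: "B \<in> carrier (orthogonal_group b)"
  shows "orth_conj (a + b) (block_sum A B) (block_sum B A)"
proof -
  define P :: "real mat" where "P = four_block_mat (0\<^sub>m b a) (1\<^sub>m b) (1\<^sub>m a) (0\<^sub>m a b)"
  have "dim_row P = a + b" "dim_col P = a + b"
    unfolding P_def by simp_all
  then have P: "P \<in> carrier_mat (a + b) (a + b)" by (rule carrier_matI)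
  have tP: "transpose_mat P = four_block_mat (0\<^sub>m a b) (1\<^sub>m a) (1\<^sub>m b) (0\<^sub>m b a)"
    unfolding P_def by (subst transpose_four_block_mat[of _ b a _ b _ a]) simp_all
  have c: "A \<in> carrier_mat a a" "B \<in> carrier_mat b b"
    using A B by (auto simp: orthogonal_group_iff)
  then have d: "dim_row A = a" "dim_col A = a" "dim_row B = b" "dim_col B = b" by auto
  have "transpose_mat P * P = 1\<^sub>m (a + b)"
    unfolding tP unfolding P_def
    by (subst mult_four_block_mat[of _ a b _ a _ b _ _ a _ b]) simp_all
  with P have "P \<in> carrier (orthogonal_group (a + b))"
    by (simp add: orthogonal_group_iff)
  moreover have "P * block_sum A B = four_block_mat (0\<^sub>m b a) B A (0\<^sub>m a b)"
    unfolding P_def block_sum_def d using c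
    by (subst mult_four_block_mat[of _ b a _ b _ a _ _ a _ b]) simp_all
  moreover have "four_block_mat (0\<^sub>m b a) B A (0\<^sub>m a b) * transpose_mat P = block_sum B A"
    unfolding tP block_sum_def d using c
    by (subst mult_four_block_mat[of _ b a _ b _ a _ _ b _ a]) simp_all
  ultimately show ?thesis
    unfolding orth_conj_def using orthogonal_block_sum[OF A B] by metis
qed

lemma char_poly_orth_conj:
  assumes "orth_conj N A B"
  shows "char_poly A = char_poly B"
proof -
  obtain g where g: "g \<in> carrier (orthogonal_group N)" "B = g * A * transpose_mat g"
    using assms unfolding orth_conj_def by blast
  have "similar_mat B A"
    using g orthogonal_transpose[OF g(1)] orth_conj_carrier[OF assms]
    by (intro similar_matI[of _ _ g "transpose_mat g" N]) (auto simp: orthogonal_group_iff)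
  then show ?thesis by (simp add: char_poly_similar)
qed

section \<open>Rotation blocks\<close>

lemma rot_carrier [simp]: "rot \<theta> \<in> carrier_mat 2 2"
  unfolding rot_def mat_of_rows_list_def by (rule carrier_matI) simp_all

lemma dim_rot [simp]: "dim_row (rot \<theta>) = 2" "dim_col (rot \<theta>) = 2"
  unfolding rot_def mat_of_rows_list_def by simp_all

lemma rot_index [simp]:
  "rot \<theta> $$ (0, 0) = cos (2 * pi * \<theta>)" "rot \<theta> $$ (0, Suc 0) = sin (2 * pi * \<theta>)"
  "rot \<theta> $$ (Suc 0, 0) = - sin (2 * pi * \<theta>)" "rot \<theta> $$ (Suc 0, Suc 0) = cos (2 * pi * \<theta>)"
  unfolding rot_def mat_of_rows_list_def by simp_all

lemma refl_block_carrier [simp]: "refl_block \<in> carrier_mat 2 2"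
  unfolding refl_block_def mat_of_rows_list_def by (rule carrier_matI) simp_all

lemma dim_refl_block [simp]: "dim_row refl_block = 2" "dim_col refl_block = 2"
  unfolding refl_block_def mat_of_rows_list_def by simp_all

lemma refl_block_index [simp]:
  "refl_block $$ (0, 0) = 1" "refl_block $$ (0, Suc 0) = 0"
  "refl_block $$ (Suc 0, 0) = 0" "refl_block $$ (Suc 0, Suc 0) = -1"
  unfolding refl_block_def mat_of_rows_list_def by simp_all

lemma eq_mat_2x2I:
  assumes "A \<in> carrier_mat 2 2" "B \<in> carrier_mat 2 2"
    and "A $$ (0, 0) = B $$ (0, 0)" "A $$ (0, Suc 0) = B $$ (0, Suc 0)"
    and "A $$ (Suc 0, 0) = B $$ (Suc 0, 0)" "A $$ (Suc 0, Suc 0) = B $$ (Suc 0, Suc 0)"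
  shows "A = B"
  by (rule eq_matI) (use assms in \<open>auto simp: less_2_cases_iff\<close>)

lemma mult_mat_2x2_index:
  assumes "A \<in> carrier_mat 2 2" "B \<in> carrier_mat 2 2" "i < 2" "j < 2"
  shows "(A * B) $$ (i, j) = A $$ (i, 0) * B $$ (0, j) + A $$ (i, Suc 0) * B $$ (Suc 0, j)"
  using assms by (simp add: scalar_prod_def numeral_2_eq_2)

lemma rot_mult: "rot a * rot b = rot (a + b)"
  by (rule eq_mat_2x2I)
    (simp_all add: mult_mat_2x2_index mult_carrier_mat[of _ 2 2] distrib_left cos_add sin_add
      del: index_mult_mat(1))

lemma rot_zero: "rot 0 = 1\<^sub>m 2"
  by (rule eq_mat_2x2I) simp_all

lemma rot_pow: "rot \<theta> ^\<^sub>m m = rot (real m * \<theta>)"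
  by (induction m) (simp_all add: rot_zero rot_mult distrib_right add.commute)

lemma transpose_rot: "transpose_mat (rot \<theta>) = rot (- \<theta>)"
  by (rule eq_mat_2x2I) simp_all

lemma rot_orthogonal [simp]: "rot \<theta> \<in> carrier (orthogonal_group 2)"
  by (simp add: orthogonal_group_iff transpose_rot rot_mult rot_zero)

lemma rot_add_int: "rot (\<theta> + of_int j) = rot \<theta>"
  by (rule eq_mat_2x2I) (simp_all add: distrib_left cos_add sin_add sin_int_2pin cos_int_2pin)

lemma rot_eq_one_iff: "rot \<theta> = 1\<^sub>m 2 \<longleftrightarrow> \<theta> \<in> \<int>"
proof
  assume "rot \<theta> = 1\<^sub>m 2"
  then have "rot \<theta> $$ (0, 0) = 1" by simp
  then obtain i :: int where "2 * pi * \<theta> = of_int i * 2 * pi"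
    by (auto simp: cos_one_2pi_int)
  then show "\<theta> \<in> \<int>" by simp
next
  assume "\<theta> \<in> \<int>"
  then obtain i where "\<theta> = of_int i" by (rule Ints_cases)
  then show "rot \<theta> = 1\<^sub>m 2"
    using rot_add_int[of 0 i] by (simp add: rot_zero)
qed

text \<open>A reflection reverses the orientation of the plane, so conjugation by it turns a
  rotation into its inverse. The reflection has determinant -1, which \<open>orth_conj\<close>
  permits.\<close>

lemma orth_conj_rot_uminus: "orth_conj 2 (rot \<theta>) (rot (- \<theta>))"
proof -
  have "transpose_mat refl_block * refl_block = 1\<^sub>m 2"
    by (rule eq_mat_2x2I) (simp_all add: mult_mat_2x2_index mult_carrier_mat[of _ 2 2] del: index_mult_mat(1))
  then have "refl_block \<in> carrier (orthogonal_group 2)"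
    by (simp add: orthogonal_group_iff)
  moreover have "rot (- \<theta>) = refl_block * rot \<theta> * transpose_mat refl_block"
    by (rule eq_mat_2x2I) (simp_all add: mult_mat_2x2_index mult_carrier_mat[of _ 2 2] del: index_mult_mat(1))
  ultimately show ?thesis
    unfolding orth_conj_def using rot_orthogonal by blast
qed

section \<open>Folded angles and the rearrangement of rotation blocks\<close>

lemma fold_angle:
  "0 \<le> fold_angle \<theta>" "fold_angle \<theta> \<le> 1 / 2"
  "\<exists>j::int. fold_angle \<theta> = \<theta> + of_int j \<or> fold_angle \<theta> = - \<theta> + of_int j"
  using theI'[OF fold_angle_ex1[of \<theta>]] unfolding fold_angle_def by blast+

lemma fold_angle_id: "0 \<le> t \<Longrightarrow> t \<le> 1 / 2 \<Longrightarrow> fold_angle t = t"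
  unfolding fold_angle_def
  by (rule the1_equality[OF fold_angle_ex1]) (auto intro: exI[of _ 0])

lemma orth_conj_rot_fold_angle: "orth_conj 2 (rot \<theta>) (rot (fold_angle \<theta>))"
proof -
  obtain j :: int where "fold_angle \<theta> = \<theta> + of_int j \<or> fold_angle \<theta> = - \<theta> + of_int j"
    using fold_angle(3) by blast
  then have "rot (fold_angle \<theta>) = rot \<theta> \<or> rot (fold_angle \<theta>) = rot (- \<theta>)"
    using rot_add_int by metis
  then show ?thesis
    using orth_conj_rot_uminus orth_conj_refl[OF rot_orthogonal] by metis
qed

lemma diag_rot_orthogonal:
  "diag_block_mat (map rot \<theta>s) \<in> carrier (orthogonal_group (2 * length \<theta>s))"
proof (induction \<theta>s)
  case (Cons \<theta> \<theta>s)
  then show ?case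
    using orthogonal_block_sum[OF rot_orthogonal Cons.IH]
    by (simp only: diag_block_mat_Cons list.map list.size) simp
next
  case Nil
  \<comment> \<open>The empty block sum is \<open>0\<^sub>m 0 0\<close>, which has to be recognised
    as the identity of \<open>O(0)\<close>.\<close>
  have "(0\<^sub>m 0 0 :: real mat) = 1\<^sub>m 0" by (rule eq_matI) auto
  then show ?case by (simp add: orthogonal_group_iff)
qed

text \<open>Induction on \<open>\<theta>s\<close>: the first angle is paired with some
  \<open>\<eta>\<close> in \<open>\<eta>s\<close> of the same folded angle, the induction hypothesis
  treats the remaining blocks, and one swap carries the block of \<open>\<eta>\<close> from the
  front to its place.\<close>

lemma orth_conj_diag_rot:
  assumes "image_mset fold_angle (mset \<theta>s) = image_mset fold_angle (mset \<eta>s)"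
  shows "orth_conj (2 * length \<theta>s) (diag_block_mat (map rot \<theta>s)) (diag_block_mat (map rot \<eta>s))"
  using assms
proof (induction \<theta>s arbitrary: \<eta>s)
  case Nil
  then show ?case using diag_rot_orthogonal[of "[]"] by (simp add: orth_conj_refl)
next
  case (Cons \<theta> \<theta>s)
  let ?D = "\<lambda>\<theta>s. diag_block_mat (map rot \<theta>s)"
  have "fold_angle \<theta> \<in># image_mset fold_angle (mset \<eta>s)"
    using Cons.prems by (metis image_mset_add_mset mset.simps(2) union_single_eq_member)
  then obtain \<eta> where \<eta>: "\<eta> \<in> set \<eta>s" "fold_angle \<theta> = fold_angle \<eta>" by auto
  obtain us vs where \<eta>s: "\<eta>s = us @ \<eta> # vs"
    using \<eta>(1) by (meson split_list)
  have m: "image_mset fold_angle (mset \<theta>s) = image_mset fold_angle (mset (us @ vs))"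
    using Cons.prems \<eta>(2) by (simp add: \<eta>s)
  then have len: "length \<theta>s = length us + length vs"
    by (metis length_append size_image_mset size_mset)
  have "orth_conj 2 (rot \<theta>) (rot \<eta>)"
    using orth_conj_rot_fold_angle[of \<theta>] orth_conj_sym[OF orth_conj_rot_fold_angle[of \<eta>]]
    by (metis \<eta>(2) orth_conj_trans)
  then have *: "orth_conj (2 + 2 * length \<theta>s) (?D (\<theta> # \<theta>s)) (?D (\<eta> # us @ vs))"
    using orth_conj_block_sum[OF _ Cons.IH[OF m]] by (simp only: diag_block_mat_Cons list.map)
  \<comment> \<open>Both sums are bracketed so that they differ only by exchanging
    \<open>rot \<eta>\<close> with the whole sum over \<open>us\<close>.\<close>
  have move: "?D (\<eta> # us @ vs) = block_sum (block_sum (rot \<eta>) (?D us)) (?D vs)"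
    using diag_block_mat_append_block_sum[of "rot \<eta> # map rot us" "map rot vs"]
    by (simp add: diag_block_mat_Cons del: diag_block_mat.simps)
  have split: "?D \<eta>s = block_sum (block_sum (?D us) (rot \<eta>)) (?D vs)"
    using diag_block_mat_append_block_sum[of "map rot us @ [rot \<eta>]" "map rot vs"]
      diag_block_mat_append_block_sum[of "map rot us" "[rot \<eta>]"]
    by (simp add: \<eta>s del: diag_block_mat.simps)
  have "orth_conj (2 + 2 * length us + 2 * length vs) (?D (\<eta> # us @ vs)) (?D \<eta>s)"
    unfolding move split
    by (intro orth_conj_block_sum orth_conj_block_sum_swap orth_conj_refl
        diag_rot_orthogonal rot_orthogonal)
  moreover have "2 + 2 * length us + 2 * length vs = 2 + 2 * length \<theta>s" using len by simp
  ultimately have "orth_conj (2 + 2 * length \<theta>s) (?D (\<eta> # us @ vs)) (?D \<eta>s)" by metis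
  then show ?case
    using orth_conj_trans[OF *] by (simp del: diag_block_mat.simps list.map)
qed

text \<open>For c = cos \<phi> the roots of x^2 - 2 c x + 1 are the conjugate pair of eigenvalues
  exp(i \<phi>) and exp(-i \<phi>).\<close>

definition rot_poly :: "real \<Rightarrow> real poly" where
  "rot_poly c = [:1, - 2 * c, 1:]"

lemma char_poly_rot: "char_poly (rot \<theta>) = rot_poly (cos (2 * pi * \<theta>))"
proof -
  have "char_poly_matrix (rot \<theta>) \<in> carrier_mat 2 2" by simp
  then have "char_poly (rot \<theta>) = [:- cos (2 * pi * \<theta>), 1:] * [:- cos (2 * pi * \<theta>), 1:]
      + [:sin (2 * pi * \<theta>):] * [:sin (2 * pi * \<theta>):]"
    unfolding char_poly_def by (subst det_2x2) (simp_all add: char_poly_matrix_def)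
  then show ?thesis
    using sin_cos_squared_add3[of "2 * pi * \<theta>"] by (simp add: rot_poly_def add.commute)
qed

lemma char_poly_diag_rot:
  "char_poly (diag_block_mat (map rot \<theta>s)) = (\<Prod>c\<in>#image_mset (\<lambda>\<theta>. cos (2 * pi * \<theta>)) (mset \<theta>s). rot_poly c)"
proof (induction \<theta>s)
  case Nil
  then show ?case by (simp add: char_poly_def char_poly_matrix_def)
next
  case (Cons \<theta> \<theta>s)
  have "diag_block_mat (map rot \<theta>s) \<in> carrier_mat (2 * length \<theta>s) (2 * length \<theta>s)"
    using diag_rot_orthogonal by (auto simp: orthogonal_group_iff)
  then show ?case
    using Cons
    by (simp add: diag_block_mat_Cons char_poly_block_sum[OF rot_carrier] char_poly_rot
        del: diag_block_mat.simps)
qed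

text \<open>A complex root \<open>z\<close> of \<open>rot_poly c\<close> is a root of the left
  product, hence of some factor \<open>rot_poly d\<close> on the right. The value of that factor at
  \<open>z\<close> is 2 (c - d) z, which forces d = c.\<close>

lemma prod_rot_poly_root:
  assumes eq: "(\<Prod>c\<in>#M. rot_poly c) = (\<Prod>c\<in>#M'. rot_poly c)" and c: "c \<in># M" "\<bar>c\<bar> \<le> 1"
  shows "c \<in># M'"
proof -
  interpret h: map_poly_comm_ring_hom "of_real :: real \<Rightarrow> complex" ..
  \<comment> \<open>The point of the unit circle with real part \<open>c\<close>; the bound on
    \<open>c\<close> makes the square of its imaginary part equal to 1 - c^2. Complex numbers enter
    because \<open>rot_poly c\<close> has no real root when |c| < 1.\<close>
  define z where "z = Complex c (sqrt (1 - c\<^sup>2))"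
  define ev where "ev p = poly (map_poly of_real p) z" for p :: "real poly"
  have ev_prod: "ev (\<Prod>c\<in>#N. rot_poly c) = (\<Prod>c\<in>#N. ev (rot_poly c))" for N
    by (induction N) (simp_all add: ev_def h.hom_mult)
  have "c\<^sup>2 \<le> 1" using c(2) by (simp add: abs_square_le_1)
  then have z: "z\<^sup>2 + 1 = 2 * of_real c * z"
    unfolding complex_eq_iff z_def power2_eq_square by simp
  have ev: "ev (rot_poly d) = 2 * (of_real c - of_real d) * z" for d
  proof -
    have "ev (rot_poly d) = (z\<^sup>2 + 1) - 2 * of_real d * z"
      by (simp add: ev_def rot_poly_def power2_eq_square algebra_simps)
    then show ?thesis unfolding z by (simp add: algebra_simps)
  qed
  have "z \<noteq> 0" using z by auto
  have "ev (\<Prod>c\<in>#M. rot_poly c) = 0"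
    using c(1) ev[of c] by (auto simp: ev_prod prod_mset_zero_iff)
  then obtain d where "d \<in># M'" "ev (rot_poly d) = 0"
    by (auto simp: eq ev_prod prod_mset_zero_iff)
  then show ?thesis using ev[of d] \<open>z \<noteq> 0\<close> by simp
qed

text \<open>By induction: the previous lemma finds each element of \<open>M\<close> in
  \<open>M'\<close>, and its nonzero factor is then cancelled on both sides.\<close>

lemma prod_rot_poly_inject:
  assumes "(\<Prod>c\<in>#M. rot_poly c) = (\<Prod>c\<in>#M'. rot_poly c)"
    and "\<forall>c\<in>#M. \<bar>c\<bar> \<le> 1" "\<forall>c\<in>#M'. \<bar>c\<bar> \<le> 1"
  shows "M = M'"
  using assms
proof (induction M arbitrary: M')
  case empty
  then have "c \<notin># M'" for c
    using prod_rot_poly_root[of M' "{#}" c] by auto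
  then show ?case by auto
next
  case (add c M)
  then have "c \<in># M'" using prod_rot_poly_root[of "add_mset c M" M' c] by auto
  then obtain N where N: "M' = add_mset c N" by (meson mset_add)
  have "rot_poly c \<noteq> 0" by (simp add: rot_poly_def)
  then show ?case using add.IH[of N] add.prems by (simp add: N)
qed

section \<open>Multisets with a prescribed number of distinct elements\<close>

text \<open>Such multisets are compositions of \<open>Suc n\<close> into \<open>card S\<close>
  positive parts. Fix \<open>a\<close> in \<open>S\<close> and remove one copy of it: either
  \<open>a\<close> still occurs or the support shrinks to \<open>S - {a}\<close>, and the two cases
  add up by Pascal's rule. Finiteness is carried along for the cardinality of the union.\<close>

lemma multisets_with_support:
  assumes "finite S" "S \<noteq> {}"
  shows "finite {M. set_mset M = S \<and> size M = Suc n} \<and>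
    card {M. set_mset M = S \<and> size M = Suc n} = n choose (card S - 1)"
  using assms
proof (induction n arbitrary: S)
  case 0
  show ?case
  proof (cases "card S = 1")
    case True
    then obtain a where "S = {a}" by (rule card_1_singletonE)
    then have "{M. set_mset M = S \<and> size M = Suc 0} = {{#a#}}"
      by (auto simp: size_1_singleton_mset One_nat_def[symmetric] simp del: One_nat_def dest: size_1_singleton_mset)
    then show ?thesis using True by simp
  next
    case False
    then have empty: "{M. set_mset M = S \<and> size M = Suc 0} = {}"
      by (auto simp del: One_nat_def simp: One_nat_def[symmetric] dest!: size_1_singleton_mset)
    have "card S - 1 > 0"
      using False 0 by (metis One_nat_def card_gt_0_iff diff_is_0_eq le_SucE le_zero_eq not_gr_zero)
    then have "0 choose (card S - 1) = 0" by (rule binomial_eq_0)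
    then show ?thesis unfolding empty by (simp only: card.empty finite.emptyI simp_thms)
  qed
next
  case (Suc n)
  obtain a where a: "a \<in> S" using Suc.prems by blast
  let ?X = "\<lambda>S n. {M. set_mset M = S \<and> size M = Suc n}"
  have "?X S (Suc n) = add_mset a ` (?X S n \<union> ?X (S - {a}) n)"
  proof (intro subset_antisym subsetI)
    fix M assume M: "M \<in> ?X S (Suc n)"
    then have "a \<in># M" using a by auto
    then obtain M' where M': "M = add_mset a M'" by (meson mset_add)
    have "M' \<in> ?X S n \<union> ?X (S - {a}) n"
      using M unfolding M' by (cases "a \<in># M'") auto
    then show "M \<in> add_mset a ` (?X S n \<union> ?X (S - {a}) n)" using M' by blast
  next
    fix M assume "M \<in> add_mset a ` (?X S n \<union> ?X (S - {a}) n)"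
    then obtain M' where M': "M = add_mset a M'" "size M' = Suc n"
      and "set_mset M' = S \<or> set_mset M' = S - {a}" by blast
    then have "insert a (set_mset M') = S" using a by blast
    then show "M \<in> ?X S (Suc n)" unfolding M'(1) using M'(2) by simp
  qed
  moreover have "?X S n \<inter> ?X (S - {a}) n = {}" using a by blast
  moreover have X: "finite (?X S n)" "card (?X S n) = n choose (card S - 1)"
    using Suc.IH[of S] Suc.prems by auto
  \<comment> \<open>This is Pascal's rule. The case S = {a} is separate because the induction
    hypothesis requires a nonempty support; then the family is empty and both binomials are
    1.\<close>
  moreover have Y: "finite (?X (S - {a}) n) \<and> card (?X (S - {a}) n) + (n choose (card S - 1)) = Suc n choose (card S - 1)"
  proof (cases "S - {a} = {}")
    case True
    then have "S = {a}" using a by auto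
    then have empty: "?X (S - {a}) n = {}" by auto
    show ?thesis unfolding empty \<open>S = {a}\<close> by simp
  next
    case False
    have c: "card (S - {a}) = card S - 1" using a Suc.prems by simp
    then have "card S - 1 \<noteq> 0" using False Suc.prems by (metis card_0_eq finite_Diff)
    then obtain t where "card S - 1 = Suc t" using not0_implies_Suc by blast
    then show ?thesis using Suc.IH[of "S - {a}"] False Suc.prems c by simp
  qed
  moreover have "card (add_mset a ` (?X S n \<union> ?X (S - {a}) n)) = card (?X S n \<union> ?X (S - {a}) n)"
    by (rule card_image) (simp add: inj_on_def)
  ultimately show ?case
    by (simp add: card_Un_disjoint)
qed

text \<open>The multisets are grouped by their support: first the support is chosen, then the
  multiplicities on it.\<close>

lemma card_multisets_distinct_elements:
  assumes "finite A"
  shows "card {M. set_mset M \<subseteq> A \<and> size M = Suc n \<and> card (set_mset M) = Suc s} =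
    (card A choose Suc s) * (n choose s)"
proof -
  let ?I = "{S. S \<subseteq> A \<and> card S = Suc s}"
  let ?X = "\<lambda>S. {M. set_mset M = S \<and> size M = Suc n}"
  have X: "finite (?X S)" "card (?X S) = n choose s" if "S \<in> ?I" for S
  proof -
    have "finite S" "S \<noteq> {}" using that finite_subset[OF _ assms] by auto
    then show "finite (?X S)" "card (?X S) = n choose s"
      using multisets_with_support[of S n] that by auto
  qed
  have "{M. set_mset M \<subseteq> A \<and> size M = Suc n \<and> card (set_mset M) = Suc s} = (\<Union>S\<in>?I. ?X S)"
    by auto
  also have "card \<dots> = (\<Sum>S\<in>?I. card (?X S))"
    using assms X(1) by (intro card_UN_disjoint) auto
  also have "\<dots> = card ?I * (n choose s)"
    using X(2) by simp
  finally show ?thesis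
    using n_subsets[OF assms, of "Suc s"] by simp
qed

section \<open>Standard forms of odd order\<close>

text \<open>The determinant is a real number with an odd power equal to 1, and 1 has only one real
  root of odd order.\<close>

lemma det_eq_one_of_odd_pow:
  fixes A :: "real mat"
  assumes "A \<in> carrier_mat n n" "A ^\<^sub>m m = 1\<^sub>m n" "odd m"
  shows "det A = 1"
proof -
  have "det A ^ m = 1" using det_pow_mat[OF assms(1), of m] assms(2) by simp
  then show ?thesis using odd_real_root_unique[of m] assms(3) by (metis power_one)
qed

lemma diag_block_mat_pow_eq_one_iff:
  fixes As :: "'a::{semiring_1} mat list"
  assumes sq: "\<forall>A\<in>set As. square_mat A"
  shows "diag_block_mat As ^\<^sub>m m = 1\<^sub>m (dim_row (diag_block_mat As)) \<longleftrightarrow>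
    (\<forall>A\<in>set As. A ^\<^sub>m m = 1\<^sub>m (dim_row A))"
proof -
  let ?Bs = "map (\<lambda>A. A ^\<^sub>m m) As"
  have pow: "diag_block_mat As ^\<^sub>m m = diag_block_mat ?Bs"
    using sq by (intro diag_block_pow_mat) auto
  have col: "dim_col A = dim_row A" if "A \<in> set As" for A
    using bspec[OF sq that] by simp
  show ?thesis
  proof
    assume "diag_block_mat As ^\<^sub>m m = 1\<^sub>m (dim_row (diag_block_mat As))"
    then have "\<forall>A\<in>set ?Bs. A = 1\<^sub>m (dim_row A)"
      unfolding pow by (intro diag_block_mat_eq_one) (auto simp: col)
    then show "\<forall>A\<in>set As. A ^\<^sub>m m = 1\<^sub>m (dim_row A)" by simp
  next
    assume "\<forall>A\<in>set As. A ^\<^sub>m m = 1\<^sub>m (dim_row A)"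
    then have "?Bs = map (\<lambda>A. 1\<^sub>m (dim_row A)) As" by simp
    then show "diag_block_mat As ^\<^sub>m m = 1\<^sub>m (dim_row (diag_block_mat As))"
      unfolding pow by (simp only: diag_block_one_mat dim_diag_block_mat)
  qed
qed

text \<open>The summand \<open>1\<^sub>m (N mod 2)\<close> is the trailing 1 in odd size and the
  empty matrix in even size, so one formula serves both parities.\<close>

definition std_rot :: "nat \<Rightarrow> real list \<Rightarrow> real mat" where
  "std_rot N \<theta>s = block_sum (diag_block_mat (map rot \<theta>s)) (1\<^sub>m (N mod 2))"

lemma std_rot_eq:
  "std_rot N \<theta>s = diag_block_mat (map rot \<theta>s @ (if even N then [] else [1\<^sub>m 1]))"
proof -
  have "(0\<^sub>m 0 0 :: real mat) = 1\<^sub>m 0" by (rule eq_matI) auto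
  then show ?thesis
    by (simp add: std_rot_def diag_block_mat_append_block_sum odd_iff_mod_2_eq_one)
qed

lemma standard_form_std_rot: "standard_form \<theta>s (std_rot N \<theta>s)"
  unfolding standard_form_def std_rot_eq by auto

lemma one_orthogonal: "1\<^sub>m n \<in> carrier (orthogonal_group n)"
  by (simp add: orthogonal_group_iff)

lemma std_rot_orthogonal:
  assumes "length \<theta>s = N div 2"
  shows "std_rot N \<theta>s \<in> carrier (orthogonal_group N)"
  using orthogonal_block_sum[OF diag_rot_orthogonal[of \<theta>s] one_orthogonal[of "N mod 2"]] assms
  by (simp add: std_rot_def)

lemma orth_conj_std_rot:
  assumes "length \<theta>s = N div 2" "image_mset fold_angle (mset \<theta>s) = image_mset fold_angle (mset \<eta>s)"
  shows "orth_conj N (std_rot N \<theta>s) (std_rot N \<eta>s)"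
  using orth_conj_block_sum[OF orth_conj_diag_rot[OF assms(2)] orth_conj_refl[OF one_orthogonal[of "N mod 2"]]]
    assms(1)
  by (simp add: std_rot_def)

lemma pow_mat_one: "1\<^sub>m n ^\<^sub>m m = (1\<^sub>m n :: 'a::semiring_1 mat)"
  by (induction m) simp_all

lemma std_rot_pow_eq_one:
  assumes "length \<theta>s = N div 2" "\<forall>\<theta>\<in>set \<theta>s. real m * \<theta> \<in> \<int>"
  shows "std_rot N \<theta>s ^\<^sub>m m = 1\<^sub>m N"
proof -
  have "dim_row (std_rot N \<theta>s) = N"
    using std_rot_orthogonal[OF assms(1)] by (auto simp: orthogonal_group_iff)
  moreover have "std_rot N \<theta>s ^\<^sub>m m = 1\<^sub>m (dim_row (std_rot N \<theta>s))"
    unfolding std_rot_eq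
    by (subst diag_block_mat_pow_eq_one_iff) (use assms in \<open>auto simp: rot_pow rot_eq_one_iff pow_mat_one\<close>)
  ultimately show ?thesis by simp
qed

text \<open>Each block has \<open>m\<close>-th power 1 with \<open>m\<close> odd, hence determinant
  1. This excludes the tails \<open>refl_block\<close> and -1, and the size of \<open>y\<close> then
  fixes both the number of rotations and the presence of the trailing 1.\<close>

lemma standard_form_odd_order:
  assumes y: "y \<in> carrier_mat N N" "y ^\<^sub>m m = 1\<^sub>m N" "standard_form \<theta>s y" and "odd m"
  shows "y = std_rot N \<theta>s" "length \<theta>s = N div 2" "\<forall>\<theta>\<in>set \<theta>s. real m * \<theta> \<in> \<int>"
proof -
  obtain tail where tail: "tail \<in> {[], [refl_block], [1\<^sub>m 1], [- 1\<^sub>m 1 :: real mat]}"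
    and y_eq: "y = diag_block_mat (map rot \<theta>s @ tail)"
    using y(3) unfolding standard_form_def by blast
  let ?As = "map rot \<theta>s @ tail"
  have "\<forall>A\<in>set ?As. square_mat A" using tail by auto
  moreover have "diag_block_mat ?As ^\<^sub>m m = 1\<^sub>m (dim_row (diag_block_mat ?As))"
    using y by (auto simp: y_eq[symmetric])
  ultimately have pow: "\<forall>A\<in>set ?As. A ^\<^sub>m m = 1\<^sub>m (dim_row A)"
    using diag_block_mat_pow_eq_one_iff by blast
  show "\<forall>\<theta>\<in>set \<theta>s. real m * \<theta> \<in> \<int>"
  proof
    fix \<theta> assume "\<theta> \<in> set \<theta>s"
    then have "rot \<theta> \<in> set ?As" by simp
    from bspec[OF pow this] show "real m * \<theta> \<in> \<int>"
      by (simp add: rot_pow rot_eq_one_iff)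
  qed
  have "det refl_block = -1" by (simp add: det_2x2)
  then have "refl_block \<notin> set tail"
    using pow det_eq_one_of_odd_pow[of refl_block 2 m] \<open>odd m\<close> by auto
  moreover have "det (- 1\<^sub>m 1 :: real mat) = -1" by (simp add: det_single)
  then have "- 1\<^sub>m 1 \<notin> set tail"
    using pow det_eq_one_of_odd_pow[of "- 1\<^sub>m 1" 1 m] \<open>odd m\<close> by auto
  ultimately have tail': "tail = [] \<or> tail = [1\<^sub>m 1]" using tail by auto
  have "N = dim_row y" using y by auto
  also have "\<dots> = 2 * length \<theta>s + sum_list (map dim_row tail)"
    unfolding y_eq by (simp add: dim_diag_block_mat comp_def sum_list_triv)
  finally have N: "N = 2 * length \<theta>s + sum_list (map dim_row tail)" .
  show "length \<theta>s = N div 2" using tail' N by auto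
  show "y = std_rot N \<theta>s" using tail' N by (auto simp: y_eq std_rot_eq)
qed

text \<open>Folding changes the angle by a sign and an integer, so \<open>2 * k + 1\<close> times
  the folded angle is still an integer \<open>w\<close>. The bounds 0 and 1/2 give 0 \<le> 2 w \<le>
  2 k + 1, and integrality improves this to w \<le> k.\<close>

lemma fold_angle_of_odd_order:
  assumes "real (2 * k + 1) * \<theta> \<in> \<int>"
  shows "\<exists>i\<le>k. fold_angle \<theta> = real i / real (2 * k + 1)"
proof -
  let ?m = "real (2 * k + 1)"
  obtain z :: int where z: "?m * \<theta> = of_int z" using assms by (rule Ints_cases)
  obtain j :: int where "fold_angle \<theta> = \<theta> + of_int j \<or> fold_angle \<theta> = - \<theta> + of_int j"
    using fold_angle(3) by blast
  moreover have "?m * (\<theta> + of_int j) = of_int (z + int (2 * k + 1) * j)"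
    unfolding distrib_left z by simp
  moreover have "?m * (- \<theta> + of_int j) = of_int (- z + int (2 * k + 1) * j)"
    unfolding distrib_left mult_minus_right z by simp
  ultimately obtain w :: int where w: "?m * fold_angle \<theta> = of_int w" by metis
  have "0 \<le> ?m * fold_angle \<theta>" "?m * fold_angle \<theta> \<le> ?m * (1 / 2)"
    using fold_angle(1,2)[of \<theta>] by (simp, intro mult_left_mono) auto
  then have "0 \<le> w" and "real_of_int (2 * w) \<le> real_of_int (int (2 * k + 1))"
    unfolding w by simp_all
  then have "0 \<le> w" "2 * w \<le> int (2 * k + 1)" by (simp_all only: of_int_le_iff)
  then have nat_w: "nat w \<le> k" "real (nat w) = real_of_int w" by auto
  have "?m \<noteq> 0" by simp
  then have "fold_angle \<theta> = real (nat w) / ?m"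
    using w nat_w(2) by (metis nonzero_mult_div_cancel_left)
  then show ?thesis using nat_w(1) by blast
qed

text \<open>The characteristic polynomial is invariant under conjugation and determines the multiset
  of cosines; on [0, 1/2] an angle is determined by its cosine.\<close>

lemma std_rot_inject:
  assumes conj: "orth_conj N (std_rot N \<theta>s) (std_rot N \<eta>s)"
    and range: "\<forall>\<theta>\<in>set \<theta>s. 0 \<le> \<theta> \<and> \<theta> \<le> 1 / 2" "\<forall>\<theta>\<in>set \<eta>s. 0 \<le> \<theta> \<and> \<theta> \<le> 1 / 2"
  shows "mset \<theta>s = mset \<eta>s"
proof -
  have c: "char_poly (std_rot N \<theta>s) = char_poly (diag_block_mat (map rot \<theta>s)) * char_poly (1\<^sub>m (N mod 2))"
    for \<theta>s
    using diag_rot_orthogonal[of \<theta>s] unfolding std_rot_def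
    by (intro char_poly_block_sum[of _ "2 * length \<theta>s" _ "N mod 2"]) (auto simp: orthogonal_group_iff)
  \<comment> \<open>The factor of the trailing block is monic, hence nonzero, and cancels.\<close>
  have "char_poly (1\<^sub>m (N mod 2) :: real mat) \<noteq> 0"
    using degree_monic_char_poly[of "1\<^sub>m (N mod 2) :: real mat" "N mod 2"] by auto
  then have "char_poly (diag_block_mat (map rot \<theta>s)) = char_poly (diag_block_mat (map rot \<eta>s))"
    using char_poly_orth_conj[OF conj] by (simp add: c)
  then have "image_mset (\<lambda>\<theta>. cos (2 * pi * \<theta>)) (mset \<theta>s) = image_mset (\<lambda>\<theta>. cos (2 * pi * \<theta>)) (mset \<eta>s)"
    unfolding char_poly_diag_rot by (intro prod_rot_poly_inject) auto
  then show ?thesis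
  proof (rule multiset.inj_map_strong[rotated])
    fix \<theta> \<eta> assume "\<theta> \<in># mset \<theta>s" "\<eta> \<in># mset \<eta>s" "cos (2 * pi * \<theta>) = cos (2 * pi * \<eta>)"
    moreover have "0 \<le> 2 * pi * \<theta> \<and> 2 * pi * \<theta> \<le> pi" "0 \<le> 2 * pi * \<eta> \<and> 2 * pi * \<eta> \<le> pi"
      using range \<open>\<theta> \<in># mset \<theta>s\<close> \<open>\<eta> \<in># mset \<eta>s\<close>
        mult_left_mono[of "2 * \<theta>" 1 pi] mult_left_mono[of "2 * \<eta>" 1 pi]
      by (auto simp: mult.left_commute)
    ultimately have "2 * pi * \<theta> = 2 * pi * \<eta>" using cos_inj_pi by blast
    then show "\<theta> = \<eta>" by simp
  qed
qed

section \<open>Counting conjugacy classes\<close>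

text \<open>A multiset of numerators encodes the folded angles. Sorting merely selects one order: by
  \<open>orth_conj_diag_rot\<close> reordering the blocks stays within the conjugacy class.\<close>

definition angles :: "nat \<Rightarrow> nat multiset \<Rightarrow> real list" where
  "angles m M = map (\<lambda>j. real j / real m) (sorted_list_of_multiset M)"

lemma mset_angles: "mset (angles m M) = image_mset (\<lambda>j. real j / real m) M"
  by (simp add: angles_def)

lemma length_angles: "length (angles m M) = size M"
  by (metis mset_angles size_image_mset size_mset)

lemma set_angles: "set (angles m M) = (\<lambda>j. real j / real m) ` set_mset M"
  by (metis mset_angles set_image_mset set_mset_mset)

section \<open>Conjugacy classes in an abstract group\<close>

definition conj_class :: "('a, 'b) monoid_scheme \<Rightarrow> 'a \<Rightarrow> 'a set" where
  "conj_class G x = {g \<otimes>\<^bsub>G\<^esub> x \<otimes>\<^bsub>G\<^esub> inv\<^bsub>G\<^esub> g |g. g \<in> carrier G}"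

lemma conjugacy_classes_eq: "conjugacy_classes G = conj_class G ` carrier G"
  by (auto simp: conjugacy_classes_def orbits_def orbit_def conj_class_def)

context group
begin

lemma conj_class_self: "x \<in> carrier G \<Longrightarrow> x \<in> conj_class G x"
  unfolding conj_class_def by (auto intro!: exI[of _ \<one>])

lemma conj_class_carrier: "x \<in> carrier G \<Longrightarrow> y \<in> conj_class G x \<Longrightarrow> y \<in> carrier G"
  unfolding conj_class_def by auto

lemma conj_class_sym:
  assumes "x \<in> carrier G" "y \<in> conj_class G x"
  shows "x \<in> conj_class G y"
proof -
  obtain g where "g \<in> carrier G" "y = g \<otimes> x \<otimes> inv g"
    using assms(2) unfolding conj_class_def by blast
  then show ?thesis
    using conj_inv[of g x] assms(1) unfolding conj_class_def by (metis (mono_tags, lifting) inv_closed mem_Collect_eq)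
qed

lemma conj_class_mono:
  assumes "x \<in> carrier G" "y \<in> conj_class G x"
  shows "conj_class G y \<subseteq> conj_class G x"
proof
  fix z assume "z \<in> conj_class G y"
  then obtain g h where "g \<in> carrier G" "h \<in> carrier G" "y = g \<otimes> x \<otimes> inv g" "z = h \<otimes> y \<otimes> inv h"
    using assms(2) unfolding conj_class_def by blast
  then show "z \<in> conj_class G x"
    using conj_mult[of g h x] assms(1) unfolding conj_class_def by blast
qed

lemma conj_class_eq:
  assumes "x \<in> carrier G" "y \<in> conj_class G x"
  shows "conj_class G y = conj_class G x"
  using conj_class_mono[OF assms] conj_class_mono[OF conj_class_carrier[OF assms] conj_class_sym[OF assms]]
  by blast

lemma pow_conj:
  assumes "g \<in> carrier G" "x \<in> carrier G" "x [^] (m::nat) = \<one>"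
  shows "(g \<otimes> x \<otimes> inv g) [^] m = \<one>"
proof -
  have "(g \<otimes> x \<otimes> inv g) [^] i = g \<otimes> x [^] i \<otimes> inv g" for i :: nat
  proof (induction i)
    case (Suc i)
    have "inv g \<otimes> (g \<otimes> (x \<otimes> inv g)) = x \<otimes> inv g"
      using assms m_assoc[of "inv g" g "x \<otimes> inv g"] by simp
    then show ?case using Suc assms by (simp add: m_assoc)
  qed (use assms in simp)
  then show ?thesis using assms by simp
qed

end

locale orthogonal_conjugation =
  fixes N :: nat and G :: "real mat monoid" (structure)
  assumes G: "G = orthogonal_group N \<or> G = special_orthogonal_group N \<and> odd N"
begin

sublocale group G
  using G group_orthogonal_group group_special_orthogonal_group by blast

lemma G_simps: "x \<otimes>\<^bsub>G\<^esub> y = x * y" "\<one>\<^bsub>G\<^esub> = 1\<^sub>m N"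
  using G by (auto simp: special_orthogonal_group_def orthogonal_group_def)

lemma G_orthogonal: "x \<in> carrier G \<Longrightarrow> x \<in> carrier (orthogonal_group N)"
  using G by (auto simp: special_orthogonal_group_def)

lemma G_carrier_mat: "x \<in> carrier G \<Longrightarrow> x \<in> carrier_mat N N"
  using G_orthogonal by (auto simp: orthogonal_group_iff)

lemma inv_G:
  assumes "x \<in> carrier G"
  shows "inv x = transpose_mat x"
proof -
  have x: "x \<in> carrier (orthogonal_group N)" using assms by (rule G_orthogonal)
  have "transpose_mat x \<in> carrier G"
    using G assms orthogonal_transpose(1)[OF x] x
    by (auto simp: special_orthogonal_group_def orthogonal_group_iff det_transpose)
  then show ?thesis
    using assms x by (intro inv_equality) (auto simp: G_simps orthogonal_group_iff)
qed

lemma pow_G: "x \<in> carrier G \<Longrightarrow> x [^] (m::nat) = x ^\<^sub>m m"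
  by (induction m) (auto simp: G_simps dest: G_carrier_mat)

text \<open>In odd size, \<open>g\<close> and \<open>- g\<close> have opposite determinants and induce the same conjugation,
  so orthogonal conjugacy can always be realised with determinant 1.\<close>

lemma orth_conj_G:
  assumes "g \<in> carrier (orthogonal_group N)"
  shows "\<exists>h\<in>carrier G. \<forall>x\<in>carrier_mat N N. h * x * transpose_mat h = g * x * transpose_mat g"
proof (cases "g \<in> carrier G")
  case False
  then have G': "G = special_orthogonal_group N" "odd N" using G assms by auto
  have g: "g \<in> carrier_mat N N" "transpose_mat g * g = 1\<^sub>m N"
    using assms by (auto simp: orthogonal_group_iff)
  let ?h = "(-1) \<cdot>\<^sub>m g"
  have "det g * det g = 1"
    using arg_cong[OF g(2), of det] g(1) by (simp add: det_mult[of _ N] det_transpose)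
  then have "det g = 1 \<or> det g = -1" by (simp add: square_eq_1_iff)
  then have "det g = -1"
    using False assms G' by (auto simp: special_orthogonal_group_def)
  then have "det ?h = 1" using G' g by (simp add: det_smult)
  have tr: "transpose_mat ?h = (-1) \<cdot>\<^sub>m transpose_mat g" by (rule eq_matI) auto
  have smult: "((-1) \<cdot>\<^sub>m A) * ((-1) \<cdot>\<^sub>m B) = A * B"
    if "A \<in> carrier_mat N N" "B \<in> carrier_mat N N" for A B :: "real mat"
  proof -
    have "((-1) \<cdot>\<^sub>m A) * ((-1) \<cdot>\<^sub>m B) = (-1) \<cdot>\<^sub>m ((-1) \<cdot>\<^sub>m (A * B))"
      using that by (simp add: mult_smult_distrib[of _ N N _ N] mult_smult_assoc_mat[of _ N N _ N])
    also have "\<dots> = A * B" by (rule eq_matI) auto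
    finally show ?thesis .
  qed
  have "?h \<in> carrier G"
    using \<open>det ?h = 1\<close> g unfolding G' special_orthogonal_group_def
    by (simp add: orthogonal_group_iff tr smult)
  moreover have "?h * x * transpose_mat ?h = g * x * transpose_mat g" if "x \<in> carrier_mat N N" for x
    using that g smult[of "g * x" "transpose_mat g"]
    by (simp add: tr mult_smult_assoc_mat[of _ N N _ N])
  ultimately show ?thesis by blast
qed blast

text \<open>Removes the difference between the groups: conjugacy in \<open>G\<close> becomes
  conjugacy in \<open>O(N)\<close>, to which the block constructions apply.\<close>

lemma conj_class_iff_orth_conj:
  assumes "x \<in> carrier G"
  shows "y \<in> conj_class G x \<longleftrightarrow> orth_conj N x y"
proof
  assume "y \<in> conj_class G x"
  then show "orth_conj N x y"
    using assms G_orthogonal by (auto simp: conj_class_def orth_conj_def G_simps inv_G)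
next
  assume "orth_conj N x y"
  then obtain g where "g \<in> carrier (orthogonal_group N)" "y = g * x * transpose_mat g"
    unfolding orth_conj_def by blast
  then obtain h where "h \<in> carrier G" "y = h * x * transpose_mat h"
    using orth_conj_G[of g] G_carrier_mat[OF assms] by metis
  then show "y \<in> conj_class G x"
    unfolding conj_class_def by (auto simp: G_simps inv_G intro!: exI[of _ h])
qed

text \<open>Odd order forces determinant 1, so representatives built in \<open>O(N)\<close> also lie
  in the special orthogonal group.\<close>

lemma odd_order_carrier:
  assumes "x \<in> carrier (orthogonal_group N)" "x ^\<^sub>m m = 1\<^sub>m N" "odd m"
  shows "x \<in> carrier G"
  using G assms det_eq_one_of_odd_pow[of x N m]
  by (auto simp: special_orthogonal_group_def orthogonal_group_iff)

context
  fixes k m :: nat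
  assumes m: "m = 2 * k + 1"
begin

lemma angle_range: "j \<le> k \<Longrightarrow> 0 \<le> real j / real m \<and> real j / real m \<le> 1 / 2"
  by (auto simp: m field_simps)

lemma inj_angle: "inj (\<lambda>j. real j / real m)"
  by (auto simp: inj_on_def m field_simps)

lemma image_fold_angle_angles:
  assumes "set_mset M \<subseteq> {..k}"
  shows "image_mset fold_angle (mset (angles m M)) = image_mset (\<lambda>j. real j / real m) M"
  unfolding mset_angles multiset.map_comp
  by (rule image_mset_cong) (use assms angle_range in \<open>auto intro!: fold_angle_id\<close>)

lemma std_rot_angles:
  assumes "size M = N div 2"
  shows "std_rot N (angles m M) \<in> carrier G" "std_rot N (angles m M) ^\<^sub>m m = 1\<^sub>m N"
proof -
  have "real m > 0" by (simp add: m)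
  then show "std_rot N (angles m M) ^\<^sub>m m = 1\<^sub>m N"
    using assms by (intro std_rot_pow_eq_one) (auto simp: length_angles set_angles)
  then show "std_rot N (angles m M) \<in> carrier G"
    using std_rot_orthogonal[of "angles m M" N] assms m
    by (intro odd_order_carrier[of _ m]) (simp_all add: length_angles del: pow_mat.simps)
qed

text \<open>Gives surjectivity in the count: \<open>x\<close> is brought to standard form, its
  angles are folded to fractions with denominator \<open>m\<close>, and \<open>M\<close> collects
  the numerators.\<close>

lemma odd_order_conj_std_rot:
  assumes x: "x \<in> carrier G" "x ^\<^sub>m m = 1\<^sub>m N" and s: "has_conj_pairs G x s"
  shows "\<exists>M. set_mset M \<subseteq> {..k} \<and> size M = N div 2 \<and> card (set_mset M) = s \<and>
    std_rot N (angles m M) \<in> conj_class G x"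
proof -
  obtain g \<theta>s where g: "g \<in> carrier G" and std: "standard_form \<theta>s (g \<otimes> x \<otimes> inv g)"
    and card: "card (fold_angle ` set \<theta>s) = s"
    using s unfolding has_conj_pairs_def by blast
  define y where "y = g \<otimes> x \<otimes> inv g"
  have y: "y \<in> conj_class G x" "y \<in> carrier G"
    using g x by (auto simp: y_def conj_class_def)
  have "y ^\<^sub>m m = 1\<^sub>m N"
    using pow_conj[OF g x(1), of m] x y pow_G by (simp add: y_def G_simps)
  note y_std = standard_form_odd_order[OF G_carrier_mat[OF y(2)] this std[folded y_def]]
  have "odd m" by (simp add: m)
  then have "\<forall>\<theta>\<in>set \<theta>s. \<exists>i. i \<le> k \<and> fold_angle \<theta> = real i / real m"
    using y_std(3) fold_angle_of_odd_order[of k] unfolding m by blast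
  then obtain f where f: "f \<theta> \<le> k" "fold_angle \<theta> = real (f \<theta>) / real m" if "\<theta> \<in> set \<theta>s" for \<theta>
    by metis
  \<comment> \<open>The multiset keeps multiplicities: its size is the number of rotation blocks,
    while its support counts the distinct folded angles.\<close>
  define M where "M = image_mset f (mset \<theta>s)"
  have M: "set_mset M \<subseteq> {..k}" "size M = N div 2"
    using f(1) y_std(2)[OF \<open>odd m\<close>] by (auto simp: M_def)
  have "fold_angle ` set \<theta>s = (\<lambda>j. real j / real m) ` set_mset M"
    using f(2) by (force simp: M_def)
  then have "card (set_mset M) = s"
    using card card_image[OF inj_on_subset[OF inj_angle subset_UNIV], of "set_mset M"] by simp
  moreover have "image_mset fold_angle (mset \<theta>s) = image_mset fold_angle (mset (angles m M))"
    unfolding image_fold_angle_angles[OF M(1)] unfolding M_def multiset.map_comp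
    by (rule image_mset_cong) (simp add: f(2))
  then have "std_rot N (angles m M) \<in> conj_class G y"
    using orth_conj_std_rot[of \<theta>s N "angles m M"] y_std(1,2)[OF \<open>odd m\<close>] y(2)
    by (simp add: conj_class_iff_orth_conj)
  ultimately show ?thesis
    using M conj_class_mono[OF x(1) y(1)] by blast
qed

text \<open>Sending \<open>M\<close> to the class of its standard rotation is a bijection:
  \<open>std_rot_inject\<close> gives injectivity, \<open>odd_order_conj_std_rot\<close>
  surjectivity, and the conditions defining the classes pass from the representative to all its
  conjugates.\<close>

lemma num_classes_eq_card_multisets:
  "num_classes G m s =
    card {M. set_mset M \<subseteq> {..k} \<and> size M = N div 2 \<and> card (set_mset M) = s}"
proof -
  let ?A = "{M. set_mset M \<subseteq> {..k} \<and> size M = N div 2 \<and> card (set_mset M) = s}"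
  let ?B = "{C \<in> conjugacy_classes G. \<forall>x\<in>C. x [^] m = \<one> \<and> has_conj_pairs G x s}"
  let ?F = "\<lambda>M. conj_class G (std_rot N (angles m M))"
  have "bij_betw ?F ?A ?B"
    unfolding bij_betw_def
  proof (intro conjI inj_onI subset_antisym subsetI)
    fix M M' assume M: "M \<in> ?A" "M' \<in> ?A" and eq: "?F M = ?F M'"
    have "std_rot N (angles m M') \<in> ?F M"
      unfolding eq using M std_rot_angles(1) by (intro conj_class_self) auto
    then have "orth_conj N (std_rot N (angles m M)) (std_rot N (angles m M'))"
      using M std_rot_angles(1) by (auto simp: conj_class_iff_orth_conj)
    then have "mset (angles m M) = mset (angles m M')"
      by (rule std_rot_inject) (use M angle_range in \<open>auto simp: set_angles subset_iff\<close>)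
    then show "M = M'"
      unfolding mset_angles by (rule multiset.inj_map_strong[rotated]) (use inj_angle in \<open>auto dest: injD\<close>)
  next
    fix C assume "C \<in> ?F ` ?A"
    then obtain M where M: "set_mset M \<subseteq> {..k}" "size M = N div 2" "card (set_mset M) = s"
      and C: "C = ?F M" by blast
    note D = std_rot_angles[OF M(2)]
    have "fold_angle ` set (angles m M) = (\<lambda>j. real j / real m) ` set_mset M"
      using arg_cong[OF image_fold_angle_angles[OF M(1)], of set_mset] by simp
    then have card: "card (fold_angle ` set (angles m M)) = s"
      using M(3) card_image[OF inj_on_subset[OF inj_angle subset_UNIV], of "set_mset M"] by simp
    have "x [^] m = \<one> \<and> has_conj_pairs G x s" if x: "x \<in> C" for x
    proof
      obtain g where g: "g \<in> carrier G" "x = g \<otimes> std_rot N (angles m M) \<otimes> inv g"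
        using x unfolding C conj_class_def by blast
      show "x [^] m = \<one>"
        unfolding g(2) using D g(1) by (intro pow_conj) (auto simp: pow_G G_simps)
      \<comment> \<open>Conjugating back by \<open>inv g\<close> reaches the representative, whose
        standard form witnesses \<open>has_conj_pairs\<close> for \<open>x\<close>.\<close>
      have "inv g \<otimes> x \<otimes> inv (inv g) = std_rot N (angles m M)"
        unfolding g(2) using D(1) g(1) by (intro conj_inv) auto
      then show "has_conj_pairs G x s"
        unfolding has_conj_pairs_def using card standard_form_std_rot g(1) by (metis inv_closed)
    qed
    then show "C \<in> ?B" using D by (auto simp: C conjugacy_classes_eq)
  next
    fix C assume C: "C \<in> ?B"
    then obtain x where x: "x \<in> carrier G" "C = conj_class G x"
      by (auto simp: conjugacy_classes_eq)
    then have "x [^] m = \<one>" "has_conj_pairs G x s"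
      using C conj_class_self by auto
    then obtain M where "M \<in> ?A" "std_rot N (angles m M) \<in> conj_class G x"
      using odd_order_conj_std_rot[of x s] x by (auto simp: pow_G G_simps)
    then show "C \<in> ?F ` ?A" using conj_class_eq[OF x(1)] x(2) by blast
  qed
  from bij_betw_same_card[OF this] show ?thesis
    unfolding num_classes_def by (rule sym)
qed

end

end

theorem theorem13:
  fixes n s m k :: nat
  assumes "n > 0" and "s > 0" and "m = 2 * k + 1"
  shows "num_classes (special_orthogonal_group (2 * n + 1)) m s =
           num_classes (orthogonal_group (2 * n + 1)) m s
       \<and> num_classes (orthogonal_group (2 * n + 1)) m s =
           num_classes (orthogonal_group (2 * n)) m s
       \<and> real (num_classes (orthogonal_group (2 * n)) m s) =
           real s / real n * real (n choose s) * real ((m div 2 + 1) choose s)"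
proof -
  obtain n' s' where ns: "n = Suc n'" "s = Suc s'"
    using assms(1,2) by (metis not0_implies_Suc not_gr_zero)
  \<comment> \<open>The count depends on \<open>N\<close> only through \<open>N div 2\<close>, which
    is \<open>n\<close> for both 2 n and 2 n + 1; this is why the three numbers agree.\<close>
  have count: "num_classes G m s = (Suc k choose Suc s') * (n' choose s')"
    if "orthogonal_conjugation N G" "N div 2 = n" for N G
    using orthogonal_conjugation.num_classes_eq_card_multisets[OF that(1) assms(3), of s]
      card_multisets_distinct_elements[of "{..k}" n' s'] that(2)
    by (simp add: ns)
  have counts: "num_classes (special_orthogonal_group (2 * n + 1)) m s = (Suc k choose Suc s') * (n' choose s')"
    "num_classes (orthogonal_group (2 * n + 1)) m s = (Suc k choose Suc s') * (n' choose s')"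
    "num_classes (orthogonal_group (2 * n)) m s = (Suc k choose Suc s') * (n' choose s')"
    by (intro count[of "2 * n + 1"] count[of "2 * n"]; simp add: orthogonal_conjugation_def)+
  \<comment> \<open>Absorption turns the binomial that counts multiplicities into the factor s/n
    times (n choose s) of the closed form.\<close>
  have "s * (n choose s) = n * (n' choose s')"
    using binomial_absorption[of s' n] unfolding ns by simp
  then have "real s * real (n choose s) = real n * real (n' choose s')"
    by (metis of_nat_mult)
  then have "real s / real n * real (n choose s) = real (n' choose s')"
    using assms(1) by simp
  \<comment> \<open>This is the number of admissible folded angles 0/m, ..., k/m.\<close>
  moreover have "m div 2 + 1 = Suc k" using assms(3) by simp
  ultimately show ?thesis unfolding counts by (simp add: ns(2) mult.commute)
qed

end
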